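(* Let $X\subseteq\mathbb{R}^n$ be a nonempty open set, $C\subseteq\mathbb{R}^m$ a closed pointed convex cone with nonempty interior, $f:X\to\mathbb{R}^m$ locally Lipschitz, $\eta:X\times X\to\mathbb{R}^n$ a mapping, and $e\in\mathbb{R}^m$ with $e>_C 0$. Suppose that $\eta$ is affine in the first argument and that $\eta(x,x)=0$ for all $x\in X$. Let $\xi\in X$ and suppose that $-f$ is approximate quasi $(\eta,e)$-invex of type II at $\xi$. If $\xi$ is a local $(\eta,e)$-quasi weak efficient solution of the vector optimization problem (VOP) $\min_{x\in X} f(x)$, then $\xi$ is a solution of (WSVVI).
   Context: Ordering: for $u,v\in\mathbb{R}^m$, $u\ge_C v$ (equivalently $v\le_C u$) means $u-v\in C$, and $u>_C v$ (equivalently $v<_C u$) means $u-v\in\operatorname{int} C$. $B(x_0,r)$ is the open ball of center $x_0$ and radius $r$; only points of $X$ are considered, since $f$ and $\eta$ are defined on $X$ and $X\times X$. Affine in the first argument: $\eta(\lambda x+(1-\lambda)x',y)=\lambda\eta(x,y)+(1-\lambda)\eta(x',y)$ for $\lambda\in[0,1]$ and $x,x',y\in X$ whenever $\lambda x+(1-\lambda)x'\in X$. Clarke's generalized Jacobian of a locally Lipschitz $g:X\to\mathbb{R}^m$ at $x\in X$ is the set of $m\times n$ matrices $\partial g(x)=\operatorname{co}\{\lim_{i\to\infty} Jg(x^{(i)}) : x^{(i)}\to x,\ x^{(i)}\in S\}$, where $\operatorname{co}$ is the convex hull, $S$ is the set of points at which $g$ is differentiable, and $Jg$ is the Jacobian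 matrix (the limits being those that exist). Approximate quasi $(\eta,e)$-invexity of type II: a locally Lipschitz $g:X\to\mathbb{R}^m$ has this property at $x_0\in X$ if there is $r>0$ such that for all $x,y\in B(x_0,r)$: if there exists $A_y\in\partial g(y)$ with $A_y\,\eta(x,y)>_C 0$, then $g(x)>_C g(y)+e\,\|\eta(x,y)\|$. (WSVVI): $\xi\in X$ is a solution of (WSVVI) if there is no $x\in X$ such that $A_\xi\,\eta(x,\xi)<_C 0$ for all $A_\xi\in\partial f(\xi)$. Local $(\eta,e)$-quasi weak efficient solution: $\xi\in X$ is such a solution of (VOP) if there is $r>0$ such that there is no $x\in B(\xi,r)$ satisfying $f(x)+e\,\|\eta(x,\xi)\|<_C f(\xi)$. *)

theory Defs
  imports "HOL-Analysis.Analysis"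
begin

definition cone_less :: "'a::real_normed_vector set \<Rightarrow> 'a \<Rightarrow> 'a \<Rightarrow> bool"
  where "cone_less C u v \<longleftrightarrow> v - u \<in> interior C"

definition pointed :: "'a::real_vector set \<Rightarrow> bool"
  where "pointed C \<longleftrightarrow> C \<inter> uminus ` C = {0}"

definition locally_lipschitz_on :: "'a::metric_space set \<Rightarrow> ('a \<Rightarrow> 'b::metric_space) \<Rightarrow> bool"
  where "locally_lipschitz_on X g \<longleftrightarrow>
    (\<forall>x\<in>X. \<exists>u>0. \<exists>L. L-lipschitz_on (ball x u \<inter> X) g)"

definition affine_in_first ::
    "'a::real_vector set \<Rightarrow> ('a \<Rightarrow> 'a \<Rightarrow> 'b::real_vector) \<Rightarrow> bool"
  where "affine_in_first X \<eta> \<longleftrightarrow>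
    (\<forall>x\<in>X. \<forall>x'\<in>X. \<forall>y\<in>X. \<forall>l\<in>{0..1}.
       l *\<^sub>R x + (1 - l) *\<^sub>R x' \<in> X \<longrightarrow>
       \<eta> (l *\<^sub>R x + (1 - l) *\<^sub>R x') y = l *\<^sub>R \<eta> x y + (1 - l) *\<^sub>R \<eta> x' y)"

text \<open>
  Maps on \<open>X\<close> are represented by total functions. Below, \<open>X\<close> is meant to be open, so that
  differentiability and the Jacobian at a point of \<open>X\<close> depend only on the values on \<open>X\<close>.
\<close>

definition clarke_jacobian ::
    "(real^'n) set \<Rightarrow> (real^'n \<Rightarrow> real^'m) \<Rightarrow> real^'n \<Rightarrow> (real^'n^'m) set"
  where "clarke_jacobian X g x =
    convex hull {A. \<exists>s :: nat \<Rightarrow> real^'n.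
      (\<forall>i. s i \<in> X \<and> g differentiable at (s i)) \<and> s \<longlonglongrightarrow> x \<and>
      (\<lambda>i. jacobian g (at (s i))) \<longlonglongrightarrow> A}"

definition approx_quasi_invex_II ::
    "(real^'n) set \<Rightarrow> (real^'m) set \<Rightarrow> (real^'n \<Rightarrow> real^'n \<Rightarrow> real^'n) \<Rightarrow> real^'m \<Rightarrow>
     (real^'n \<Rightarrow> real^'m) \<Rightarrow> real^'n \<Rightarrow> bool"
  where "approx_quasi_invex_II X C \<eta> e g x0 \<longleftrightarrow>
    (\<exists>r>0. \<forall>x \<in> ball x0 r \<inter> X. \<forall>y \<in> ball x0 r \<inter> X.
       (\<exists>A \<in> clarke_jacobian X g y. cone_less C 0 (A *v \<eta> x y)) \<longrightarrow>
       cone_less C (g y + norm (\<eta> x y) *\<^sub>R e) (g x))"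

definition WSVVI_solution ::
    "(real^'n) set \<Rightarrow> (real^'m) set \<Rightarrow> (real^'n \<Rightarrow> real^'n \<Rightarrow> real^'n) \<Rightarrow>
     (real^'n \<Rightarrow> real^'m) \<Rightarrow> real^'n \<Rightarrow> bool"
  where "WSVVI_solution X C \<eta> f \<xi> \<longleftrightarrow>
    \<xi> \<in> X \<and> \<not> (\<exists>x\<in>X. \<forall>A \<in> clarke_jacobian X f \<xi>. cone_less C (A *v \<eta> x \<xi>) 0)"

definition local_quasi_weak_efficient ::
    "(real^'n) set \<Rightarrow> (real^'m) set \<Rightarrow> (real^'n \<Rightarrow> real^'n \<Rightarrow> real^'n) \<Rightarrow> real^'m \<Rightarrow>
     (real^'n \<Rightarrow> real^'m) \<Rightarrow> real^'n \<Rightarrow> bool"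
  where "local_quasi_weak_efficient X C \<eta> e f \<xi> \<longleftrightarrow>
    \<xi> \<in> X \<and>
    (\<exists>r>0. \<not> (\<exists>x \<in> ball \<xi> r \<inter> X. cone_less C (f x + norm (\<eta> x \<xi>) *\<^sub>R e) (f \<xi>)))"

end

theory Submission
  imports Defs
begin

text \<open>
  Suppose that some \<open>x\<close> violates the variational inequality, that is,
  \<open>A *v \<eta> x \<xi> <\<^sub>C 0\<close> for all \<open>A\<close> in Clarke's Jacobian of \<open>f\<close> at \<open>\<xi>\<close>. For \<open>l \<in> (0,1)\<close> let
  \<open>y = l x + (1 - l) \<xi>\<close>. As \<open>\<eta>\<close> is affine in its first argument and vanishes on the diagonal,
  \<open>\<eta> y \<xi> = l \<eta> x \<xi>\<close>. Hence \<open>(- A) *v \<eta> y \<xi> >\<^sub>C 0\<close>, where \<open>- A\<close> belongs to Clarke's Jacobian of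
  \<open>- f\<close>. For small \<open>l\<close>, invexity of \<open>- f\<close> yields \<open>- f y >\<^sub>C - f \<xi> + norm (\<eta> y \<xi>) e\<close>, that is,
  \<open>f y + norm (\<eta> y \<xi>) e <\<^sub>C f \<xi>\<close>, against the local efficiency of \<open>\<xi>\<close>.

  The argument needs at least one matrix \<open>A\<close>: over an empty Jacobian, every \<open>x\<close> would violate the
  inequality. So the analytic core is that Clarke's Jacobian of a locally Lipschitz map is
  nonempty (lemma \<open>clarke_jacobian_common_element\<close>). Jacobians of a Lipschitz map are bounded, and
  by compactness it suffices to find points of differentiability arbitrarily close to \<open>\<xi>\<close>. They
  come from Rademacher's theorem (lemma \<open>rademacher\<close>): a Lipschitz map is differentiable almost
  everywhere.

  Rademacher's theorem is proved here by a porosity argument. In one variable, it follows from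
  Vitali's covering theorem applied to the Stieltjes measure of an increasing function. By Tonelli's
  theorem, almost every point of the space then has all partial derivatives. Sort these points into
  countably many closed sets, on each of which the partial difference quotients are within
  \<open>\<epsilon>\<close> of fixed slopes up to a fixed scale. Almost no point of such a set sees holes of relative
  size \<open>\<epsilon>\<close> in the set at arbitrarily small distances (lemma \<open>porous_points_negligible\<close>). Around
  every other point, one can move coordinate by coordinate while staying close to the set, so that
  the partial slopes combine to a linear approximation of the increment with an error of order
  \<open>\<epsilon>\<close> (lemma \<open>almost_linear_at_nonporous_point\<close>).
\<close>

section \<open>Comparison of measures by Vitali coverings\<close>

text \<open>
  Vitali's theorem extracts from the given balls countably many disjoint ones that cover almost
  all of \<open>S\<close>, and a measure inequality on each ball adds up over a disjoint family. The union \<open>W\<close> of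
  the chosen balls is returned in place of \<open>S\<close>, which need not be measurable.
\<close>
lemma vitali_comparison:
  fixes S U :: "'a::euclidean_space set" and \<nu> :: "'a measure"
  assumes \<nu>: "sets \<nu> = sets borel" and U: "open U" "S \<subseteq> U"
    and fine: "\<And>x d. x \<in> S \<Longrightarrow> 0 < d \<Longrightarrow> \<exists>a r. 0 < r \<and> r < d \<and> x \<in> cball a r \<and>
                 q * emeasure lborel (cball a r) \<le> emeasure \<nu> (cball a r)"
  obtains W where "W \<in> sets borel" "negligible (S - W)" "q * emeasure lborel W \<le> emeasure \<nu> U"
proof -
  define K where "K = {(a, r). 0 < r \<and> cball a r \<subseteq> U \<and>
    q * emeasure lborel (cball a r) \<le> emeasure \<nu> (cball a r)}"
  have small: "\<exists>i. i \<in> K \<and> x \<in> cball (fst i) (snd i) \<and> snd i < d" if "x \<in> S" "0 < d" for x d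
  proof -
    obtain u where u: "u > 0" "ball x u \<subseteq> U"
      using U \<open>x \<in> S\<close> by (meson openE subsetD)
    obtain a r where ar: "0 < r" "r < min d (u/2)" "x \<in> cball a r"
        "q * emeasure lborel (cball a r) \<le> emeasure \<nu> (cball a r)"
      using fine[OF \<open>x \<in> S\<close>, of "min d (u/2)"] \<open>0 < d\<close> u by auto
    (* a ball of radius below u/2 that contains x stays inside the ball of radius u around x *)
    have "dist x y < u" if "y \<in> cball a r" for y
      using ar that dist_triangle[of x y a] by (auto simp: dist_commute)
    then have "cball a r \<subseteq> U"
      using u by auto
    then show ?thesis
      using ar by (intro exI[of _ "(a, r)"]) (auto simp: K_def)
  qed
  have pos: "0 < snd i" if "i \<in> K" for i
    using that by (auto simp: K_def)
  obtain C where C: "countable C" "C \<subseteq> K"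
     "pairwise (\<lambda>i j. disjnt (cball (fst i) (snd i)) (cball (fst j) (snd j))) C"
     "negligible (S - (\<Union>i \<in> C. cball (fst i) (snd i)))"
    by (rule Vitali_covering_theorem_cballs[of K snd S fst, OF pos small])
  define B where "B i = cball (fst i) (snd i)" for i :: "'a \<times> real"
  have B: "B i \<subseteq> U" "q * emeasure lborel (B i) \<le> emeasure \<nu> (B i)" if "i \<in> C" for i
    using that C(2) by (cases i; force simp: K_def B_def)+
  have disj: "disjoint_family_on B C"
    using C(3) by (auto simp: disjoint_family_on_def pairwise_def disjnt_def B_def)
  have "q * emeasure lborel (\<Union>i\<in>C. B i) = q * (\<integral>\<^sup>+i. emeasure lborel (B i) \<partial>count_space C)"
    using disj C(1) by (subst emeasure_UN_countable) (auto simp: B_def)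
  also have "\<dots> = (\<integral>\<^sup>+i. q * emeasure lborel (B i) \<partial>count_space C)"
    by (simp add: nn_integral_cmult)
  also have "\<dots> \<le> (\<integral>\<^sup>+i. emeasure \<nu> (B i) \<partial>count_space C)"
    using B(2) by (intro nn_integral_mono) auto
  also have "\<dots> = emeasure \<nu> (\<Union>i\<in>C. B i)"
    using disj C(1) by (subst emeasure_UN_countable) (auto simp: B_def \<nu>)
  also have "\<dots> \<le> emeasure \<nu> U"
    using B(1) U(1) by (intro emeasure_mono) (auto simp: \<nu>)
  finally show ?thesis
    using C by (intro that[of "\<Union>i\<in>C. B i"]) (auto simp: B_def)
qed

text \<open>
  A weak form of Lebesgue's density theorem. Compare Lebesgue measure outside \<open>A\<close> with Lebesgue
  measure: on an open set \<open>U\<close> that exceeds \<open>A\<close> by very little, the former is tiny, so the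
  comparison forces almost all of \<open>P\<close> into a set of tiny measure.
\<close>
lemma negligible_low_density:
  fixes P A :: "'a::euclidean_space set"
  assumes A: "A \<in> sets borel" "P \<subseteq> A" and c: "0 < c"
    and fine: "\<And>x d. x \<in> P \<Longrightarrow> 0 < d \<Longrightarrow> \<exists>a r. 0 < r \<and> r < d \<and> x \<in> cball a r \<and>
                 ennreal c * emeasure lborel (cball a r) \<le> emeasure lborel (cball a r - A)"
  shows "negligible P"
  unfolding negligible_outer
proof (intro allI impI)
  fix \<epsilon> :: real assume "0 < \<epsilon>"
  then have e: "c * \<epsilon> / 2 > 0" using c by simp
  obtain U where U: "open U" "A \<subseteq> U" "(U - A) \<in> lmeasurable" "emeasure lebesgue (U - A) < ennreal (c * \<epsilon> / 2)"
    using sets_lebesgue_outer_open[OF _ e, of A] A by auto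
  define \<nu> where "\<nu> = density lborel (indicator (- A) :: 'a \<Rightarrow> ennreal)"
  have \<nu>: "emeasure \<nu> B = emeasure lborel (B - A)" if "B \<in> sets borel" for B
    using that A unfolding \<nu>_def
    by (subst emeasure_density) (auto simp: indicator_inter_arith[symmetric] Diff_eq Int_commute)
  have "\<exists>a r. 0 < r \<and> r < d \<and> x \<in> cball a r \<and>
      ennreal c * emeasure lborel (cball a r) \<le> emeasure \<nu> (cball a r)" if "x \<in> P" "0 < d" for x d
    using fine[OF that] by (simp add: \<nu>)
  moreover have "sets \<nu> = sets borel" by (simp add: \<nu>_def)
  ultimately obtain W where W: "W \<in> sets borel" "negligible (P - W)"
      "ennreal c * emeasure lborel W \<le> emeasure \<nu> U"
    using vitali_comparison[of \<nu> U P "ennreal c"] U A by blast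
  have "ennreal c * emeasure lborel W < ennreal (c * \<epsilon> / 2)"
    using W(3) U A by (auto simp: \<nu>)
  also have "\<dots> = ennreal c * ennreal (\<epsilon> / 2)"
    using c by (simp flip: ennreal_mult')
  finally have "emeasure lborel W < ennreal (\<epsilon> / 2)"
    by (meson mult_left_mono not_le zero_le)
  then have "emeasure lebesgue W < ennreal (\<epsilon> / 2)"
    using W(1) by simp
  then have Wm: "W \<in> lmeasurable" "measure lebesgue W < \<epsilon>"
  proof -
    have fin: "emeasure lebesgue W < top"
      using \<open>emeasure lebesgue W < ennreal (\<epsilon> / 2)\<close> ennreal_less_top by (rule less_trans)
    then show "W \<in> lmeasurable"
      using W(1) by (intro fmeasurableI) auto
    have "ennreal (measure lebesgue W) < ennreal (\<epsilon> / 2)"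
      using \<open>emeasure lebesgue W < ennreal (\<epsilon> / 2)\<close> fin by (simp add: emeasure_eq_ennreal_measure)
    then show "measure lebesgue W < \<epsilon>"
      using \<open>0 < \<epsilon>\<close> by (simp add: ennreal_less_iff)
  qed
  have PW: "P - W \<in> lmeasurable" "measure lebesgue (P - W) = 0"
    using W(2) unfolding negligible_iff_measure by blast+
  have "measure lebesgue (W \<union> (P - W)) \<le> measure lebesgue W + measure lebesgue (P - W)"
    using Wm PW by (intro measure_Un_le) auto
  then have "measure lebesgue (W \<union> (P - W)) < \<epsilon>"
    using Wm(2) PW(2) by simp
  moreover have "W \<union> (P - W) \<in> lmeasurable"
    using Wm(1) PW(1) by (rule fmeasurable.Un)
  ultimately show "\<exists>T. P \<subseteq> T \<and> T \<in> lmeasurable \<and> measure lebesgue T < \<epsilon>"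
    by (intro exI[of _ "W \<union> (P - W)"]) auto
qed

section \<open>Differentiability of Lipschitz functions of one real variable\<close>

lemma cball_between:
  fixes x t :: real
  shows "cball (x + t / 2) (\<bar>t\<bar> / 2) = {min x (x + t)..max x (x + t)}"
  unfolding cball_eq_atLeastAtMost by (auto simp: min_def max_def field_simps)

lemma emeasure_lborel_mono_negligible:
  assumes "A \<in> sets borel" "B \<in> sets borel" "negligible (A - B)"
  shows "emeasure lborel A \<le> emeasure lborel B"
proof (rule emeasure_mono_AE)
  have "A - B \<in> null_sets lborel"
    using assms by (simp add: negligible_iff_null_sets null_sets_def)
  then show "AE x in lborel. x \<in> A \<longrightarrow> x \<in> B"
    by (rule AE_I') auto
qed (use assms in simp)

text \<open>
  Lebesgue's argument. Let \<open>\<nu>\<close> be the Stieltjes measure of \<open>F\<close>, so that difference quotients are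
  ratios of \<open>\<nu>\<close> to length. In an interval \<open>I\<close> with quotient below \<open>p\<close>, the exceptional points can
  be covered by disjoint intervals with quotient above \<open>q\<close>; since their total \<open>\<nu>\<close>-mass is at most
  that of \<open>I\<close>, the exceptional set fills at most the proportion \<open>p / q\<close> of \<open>I\<close>. Such intervals
  exist at every small scale, so the density criterion applies.
\<close>
lemma negligible_oscillating_quotient:
  fixes F :: "real \<Rightarrow> real"
  assumes F: "mono F" "continuous_on UNIV F" and pq: "0 < p" "p < q"
  shows "negligible {x. (\<forall>d>0. \<exists>t. 0 < \<bar>t\<bar> \<and> \<bar>t\<bar> < d \<and> (F (x + t) - F x) / t < p) \<and>
                        (\<forall>d>0. \<exists>t. 0 < \<bar>t\<bar> \<and> \<bar>t\<bar> < d \<and> q < (F (x + t) - F x) / t)}" (is "negligible ?N")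
proof -
  define \<nu> where "\<nu> = interval_measure F"
  have Icc: "emeasure \<nu> (cball (x + t / 2) (\<bar>t\<bar> / 2)) = ennreal ((F (x + t) - F x) / t * \<bar>t\<bar>)"
    if "t \<noteq> 0" for x t
  proof -
    have "emeasure \<nu> (cball (x + t / 2) (\<bar>t\<bar> / 2)) = ennreal (F (max x (x + t)) - F (min x (x + t)))"
      unfolding cball_between \<nu>_def using F
      by (intro emeasure_interval_measure_Icc) (auto simp: mono_def)
    also have "F (max x (x + t)) - F (min x (x + t)) = (F (x + t) - F x) / t * \<bar>t\<bar>"
      using that by (auto simp: min_def max_def abs_if)
    finally show ?thesis .
  qed
  have op: "open {x. \<exists>t. 0 < \<bar>t\<bar> \<and> \<bar>t\<bar> < d \<and> (F (x + t) - F x) / t < p}"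
           "open {x. \<exists>t. 0 < \<bar>t\<bar> \<and> \<bar>t\<bar> < d \<and> q < (F (x + t) - F x) / t}" for d p q
  proof -
    have cont: "continuous_on UNIV (\<lambda>x. (F (x + t) - F x) / t)" if "0 < \<bar>t\<bar>" for t
      using that
      by (intro continuous_intros continuous_on_compose2[OF F(2)]) auto
    have "{x. \<exists>t. 0 < \<bar>t\<bar> \<and> \<bar>t\<bar> < d \<and> (F (x + t) - F x) / t < p} =
        (\<Union>t\<in>{t. 0 < \<bar>t\<bar> \<and> \<bar>t\<bar> < d}. {x. (F (x + t) - F x) / t < p})"
      "{x. \<exists>t. 0 < \<bar>t\<bar> \<and> \<bar>t\<bar> < d \<and> q < (F (x + t) - F x) / t} =
        (\<Union>t\<in>{t. 0 < \<bar>t\<bar> \<and> \<bar>t\<bar> < d}. {x. q < (F (x + t) - F x) / t})"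
      by blast+
    then show "open {x. \<exists>t. 0 < \<bar>t\<bar> \<and> \<bar>t\<bar> < d \<and> (F (x + t) - F x) / t < p}"
           "open {x. \<exists>t. 0 < \<bar>t\<bar> \<and> \<bar>t\<bar> < d \<and> q < (F (x + t) - F x) / t}"
      using cont by (auto intro!: open_UN open_Collect_less simp del: zero_less_abs_iff)
  qed
  (* The exceptional set is a G-delta: the scales d can be restricted to a sequence. *)
  have "?N = (\<Inter>n. {x. \<exists>t. 0 < \<bar>t\<bar> \<and> \<bar>t\<bar> < inverse (real (Suc n)) \<and> (F (x + t) - F x) / t < p}) \<inter>
             (\<Inter>n. {x. \<exists>t. 0 < \<bar>t\<bar> \<and> \<bar>t\<bar> < inverse (real (Suc n)) \<and> q < (F (x + t) - F x) / t})"
    (is "_ = ?M")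
  proof (intro equalityI subsetI)
    fix x assume "x \<in> ?N" then show "x \<in> ?M" by simp
  next
    fix x assume "x \<in> ?M"
    then have *: "\<exists>t. 0 < \<bar>t\<bar> \<and> \<bar>t\<bar> < inverse (real (Suc n)) \<and> (F (x + t) - F x) / t < p"
        "\<exists>t. 0 < \<bar>t\<bar> \<and> \<bar>t\<bar> < inverse (real (Suc n)) \<and> q < (F (x + t) - F x) / t" for n
      by blast+
    show "x \<in> ?N"
      using * by (blast dest: reals_Archimedean intro: order.strict_trans)
  qed
  also have "\<dots> \<in> sets borel"
    by (intro sets.Int sets.countable_INT) (use op in auto)
  finally have N: "?N \<in> sets borel" .
  show ?thesis
  proof (rule negligible_low_density[OF N order.refl, of "1 - p / q"])
    fix x d :: real assume x: "x \<in> ?N" and "0 < d"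
    then obtain t where t: "0 < \<bar>t\<bar>" "\<bar>t\<bar> < d" "(F (x + t) - F x) / t < p"
      by blast
    define a r where "a = x + t / 2" and "r = \<bar>t\<bar> / 2"
    have r: "r > 0" "2 * r = \<bar>t\<bar>" using t by (auto simp: r_def)
    have le: "emeasure \<nu> (cball a r) \<le> ennreal (p * (2 * r))"
    proof -
      have "emeasure \<nu> (cball a r) = ennreal ((F (x + t) - F x) / t * \<bar>t\<bar>)"
        unfolding a_def r_def using t(1) by (intro Icc) auto
      also have "\<dots> \<le> ennreal (p * \<bar>t\<bar>)"
        using t(3) by (intro ennreal_leI mult_right_mono) auto
      finally show ?thesis by (simp only: r(2))
    qed
    have "\<exists>b s. 0 < s \<and> s < \<delta> \<and> y \<in> cball b s \<and>
        ennreal q * emeasure lborel (cball b s) \<le> emeasure \<nu> (cball b s)"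
      if y: "y \<in> ?N \<inter> ball a r" and \<delta>: "0 < \<delta>" for y \<delta> :: real
    proof -
      obtain s where s: "0 < \<bar>s\<bar>" "\<bar>s\<bar> < \<delta>" "q < (F (y + s) - F y) / s"
        using y \<delta> by blast
      have "ennreal q * emeasure lborel (cball (y + s / 2) (\<bar>s\<bar> / 2)) = ennreal (q * \<bar>s\<bar>)"
        using pq by (simp add: cball_eq_atLeastAtMost ennreal_mult)
      also have "\<dots> \<le> ennreal ((F (y + s) - F y) / s * \<bar>s\<bar>)"
        using s(3) by (intro ennreal_leI mult_right_mono) auto
      also have "\<dots> = emeasure \<nu> (cball (y + s / 2) (\<bar>s\<bar> / 2))"
        using s(1) by (intro Icc[symmetric]) auto
      finally show ?thesis
        using s by (intro exI[of _ "y + s / 2"] exI[of _ "\<bar>s\<bar> / 2"]) (auto simp: cball_between)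
    qed
    moreover have "sets \<nu> = sets borel" by (simp add: \<nu>_def)
    ultimately obtain W where W: "W \<in> sets borel" "negligible (?N \<inter> ball a r - W)"
        "ennreal q * emeasure lborel W \<le> emeasure \<nu> (ball a r)"
      using vitali_comparison[of \<nu> "ball a r" "?N \<inter> ball a r" "ennreal q"] by blast
    have "emeasure \<nu> (ball a r) \<le> emeasure \<nu> (cball a r)"
      by (intro emeasure_mono) (auto simp: \<nu>_def)
    with W(3) le have "ennreal q * emeasure lborel W \<le> ennreal (p * (2 * r))"
      by (meson order.trans)
    also have "\<dots> = ennreal q * ennreal (p / q * (2 * r))"
      using pq r by (simp flip: ennreal_mult)
    finally have Wle: "emeasure lborel W \<le> ennreal (p / q * (2 * r))"
      using pq by (subst (asm) ennreal_mult_le_mult_iff) auto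
    have "emeasure lborel (cball a r) \<le> emeasure lborel ((cball a r - ?N) \<union> W)"
    proof (rule emeasure_lborel_mono_negligible)
      have "negligible ((?N \<inter> ball a r - W) \<union> sphere a r)"
        using W(2) by (intro negligible_Un negligible_sphere)
      then show "negligible (cball a r - ((cball a r - ?N) \<union> W))"
      proof (rule negligible_subset)
        have "cball a r \<subseteq> ball a r \<union> sphere a r" by auto
        then show "cball a r - ((cball a r - ?N) \<union> W) \<subseteq> (?N \<inter> ball a r - W) \<union> sphere a r"
          by blast
      qed
      show "(cball a r - ?N) \<union> W \<in> sets borel"
        by (intro sets.Un sets.Diff N W(1)) simp
    qed simp
    also have "\<dots> \<le> emeasure lborel (cball a r - ?N) + emeasure lborel W"
    proof (rule emeasure_subadditive)
      show "cball a r - ?N \<in> sets lborel"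
        unfolding sets_lborel by (intro sets.Diff N) simp
    qed (use W(1) in simp)
    also have "\<dots> \<le> emeasure lborel (cball a r - ?N) + ennreal (p / q * (2 * r))"
      using Wle by (intro add_left_mono)
    finally have "ennreal (2 * r) \<le> ennreal (p / q * (2 * r)) + emeasure lborel (cball a r - ?N)"
      using r by (simp add: cball_eq_atLeastAtMost add.commute)
    then have "ennreal (2 * r) - ennreal (p / q * (2 * r)) \<le> emeasure lborel (cball a r - ?N)"
      by (simp add: ennreal_minus_le_iff)
    moreover have "ennreal (1 - p / q) * emeasure lborel (cball a r) = ennreal (2 * r) - ennreal (p / q * (2 * r))"
      using pq r by (simp add: cball_eq_atLeastAtMost ennreal_minus algebra_simps flip: ennreal_mult)
    ultimately show "\<exists>a r. 0 < r \<and> r < d \<and> x \<in> cball a r \<and>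
        ennreal (1 - p / q) * emeasure lborel (cball a r) \<le> emeasure lborel (cball a r - ?N)"
      using r t by (intro exI[of _ a] exI[of _ r]) (auto simp: a_def r_def cball_between)
  qed (use pq in auto)
qed

text \<open>
  Off the exceptional sets for rational \<open>p < q\<close>, the bounded difference quotient has no room
  to oscillate.
\<close>
lemma mono_lipschitz_differentiable_ae:
  fixes F :: "real \<Rightarrow> real"
  assumes F: "mono F" "L-lipschitz_on UNIV F"
  shows "negligible {x. \<not> F differentiable at x}"
proof -
  define N where "N p q = {x. (\<forall>d>0. \<exists>t. 0 < \<bar>t\<bar> \<and> \<bar>t\<bar> < d \<and> (F (x + t) - F x) / t < p) \<and>
                        (\<forall>d>0. \<exists>t. 0 < \<bar>t\<bar> \<and> \<bar>t\<bar> < d \<and> q < (F (x + t) - F x) / t)}" for p q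
  have "negligible (\<Union>(p, q)\<in>{(p, q). p \<in> \<rat> \<and> q \<in> \<rat> \<and> 0 < p \<and> p < q}. N p q)"
  proof (rule negligible_countable_Union)
    show "countable ((\<lambda>(p, q). N p q) ` {(p, q). p \<in> \<rat> \<and> q \<in> \<rat> \<and> 0 < p \<and> p < q})"
      by (rule countable_image, rule countable_subset[of _ "\<rat> \<times> \<rat>"]) (auto intro: countable_rat)
    show "negligible S" if "S \<in> (\<lambda>(p, q). N p q) ` {(p, q). p \<in> \<rat> \<and> q \<in> \<rat> \<and> 0 < p \<and> p < q}" for S
      using that negligible_oscillating_quotient[OF F(1) lipschitz_on_continuous_on[OF F(2)]]
      by (auto simp: N_def)
  qed
  moreover have "F differentiable at x"
    if x: "\<And>p q. p \<in> \<rat> \<Longrightarrow> q \<in> \<rat> \<Longrightarrow> 0 < p \<Longrightarrow> p < q \<Longrightarrow> x \<notin> N p q" for x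
  proof -
    define Q where "Q t = (F (x + t) - F x) / t" for t
    have Q0: "0 \<le> Q t" for t
      using monoD[OF F(1), of x "x + t"] monoD[OF F(1), of "x + t" x]
      by (cases "t \<ge> 0") (auto simp: Q_def divide_nonpos_neg)
    have QL: "Q t \<le> L" if "t \<noteq> 0" for t
    proof -
      have "\<bar>F (x + t) - F x\<bar> \<le> L * \<bar>t\<bar>"
        using lipschitz_onD[OF F(2), of "x + t" x] by (simp add: dist_real_def)
      then have "\<bar>Q t\<bar> \<le> L"
        using that by (simp add: Q_def abs_divide divide_le_eq)
      then show ?thesis by simp
    qed
    define Y where "Y = {y. \<exists>d>0. \<forall>t. 0 < \<bar>t\<bar> \<and> \<bar>t\<bar> < d \<longrightarrow> y \<le> Q t}"
    have "0 \<in> Y" using Q0 by (auto simp: Y_def intro!: exI[of _ 1])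
    have bdd: "bdd_above Y"
    proof (rule bdd_aboveI)
      fix y assume "y \<in> Y"
      then obtain d where "d > 0" "\<And>t. 0 < \<bar>t\<bar> \<Longrightarrow> \<bar>t\<bar> < d \<Longrightarrow> y \<le> Q t"
        by (auto simp: Y_def)
      from this(1) this(2)[of "d/2"] QL[of "d/2"] show "y \<le> L" by simp
    qed
    (* l is the lower limit of the difference quotient *)
    define l where "l = Sup Y"
    have "0 \<le> l" unfolding l_def using \<open>0 \<in> Y\<close> bdd by (rule cSup_upper)
    have low: "\<exists>d>0. \<forall>t. 0 < \<bar>t\<bar> \<and> \<bar>t\<bar> < d \<longrightarrow> l - \<epsilon> < Q t" if "\<epsilon> > 0" for \<epsilon>
    proof -
      obtain y where "y \<in> Y" "l - \<epsilon> < y"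
      proof -
        have "Y \<noteq> {}" "l - \<epsilon> < Sup Y"
          using \<open>0 \<in> Y\<close> \<open>\<epsilon> > 0\<close> by (auto simp: l_def)
        then show thesis using less_cSupD that by blast
      qed
      then show ?thesis by (force simp: Y_def)
    qed
    have freq: "\<exists>t. 0 < \<bar>t\<bar> \<and> \<bar>t\<bar> < d \<and> Q t < y" if "l < y" "0 < d" for y d
    proof (rule ccontr)
      assume "\<not> ?thesis"
      then have "y \<in> Y" using \<open>0 < d\<close> by (force simp: Y_def)
      then have "y \<le> l" unfolding l_def using bdd by (rule cSup_upper)
      with \<open>l < y\<close> show False by simp
    qed
    have up: "\<exists>d>0. \<forall>t. 0 < \<bar>t\<bar> \<and> \<bar>t\<bar> < d \<longrightarrow> Q t < l + \<epsilon>" if "\<epsilon> > 0" for \<epsilon>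
    proof -
      obtain p where p: "p \<in> \<rat>" "l < p" "p < l + \<epsilon>"
        using Rats_dense_in_real[of l "l + \<epsilon>"] \<open>\<epsilon> > 0\<close> by auto
      obtain q where q: "q \<in> \<rat>" "p < q" "q < l + \<epsilon>"
        using Rats_dense_in_real[of p "l + \<epsilon>"] p by auto
      have "x \<notin> N p q" using x p q \<open>0 \<le> l\<close> by auto
      then obtain d where d: "d > 0" "\<And>t. 0 < \<bar>t\<bar> \<Longrightarrow> \<bar>t\<bar> < d \<Longrightarrow> Q t \<le> q"
        using freq[OF p(2)] unfolding N_def mem_Collect_eq Q_def by (meson not_le)
      show ?thesis
        using d(1) by (rule exI[of _ d, OF conjI]) (use d(2) q(3) in force)
    qed
    have "Q \<midarrow>0\<rightarrow> l"
      unfolding LIM_def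
    proof (intro allI impI)
      fix \<epsilon> :: real assume "\<epsilon> > 0"
      obtain d1 d2 where "d1 > 0" "\<forall>t. 0 < \<bar>t\<bar> \<and> \<bar>t\<bar> < d1 \<longrightarrow> l - \<epsilon> < Q t"
          "d2 > 0" "\<forall>t. 0 < \<bar>t\<bar> \<and> \<bar>t\<bar> < d2 \<longrightarrow> Q t < l + \<epsilon>"
        using low[OF \<open>\<epsilon> > 0\<close>] up[OF \<open>\<epsilon> > 0\<close>] by blast
      then show "\<exists>s>0. \<forall>t. t \<noteq> 0 \<and> dist t 0 < s \<longrightarrow> dist (Q t) l < \<epsilon>"
        by (intro exI[of _ "min d1 d2"]) (force simp: dist_real_def abs_less_iff)
    qed
    then have "(F has_field_derivative l) (at x)"
      unfolding DERIV_def Q_def .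
    then show ?thesis
      unfolding has_field_derivative_def by (rule differentiableI)
  qed
  then have "{x. \<not> F differentiable at x} \<subseteq> (\<Union>(p, q)\<in>{(p, q). p \<in> \<rat> \<and> q \<in> \<rat> \<and> 0 < p \<and> p < q}. N p q)"
    by blast
  ultimately show ?thesis
    by (rule negligible_subset)
qed

text \<open>Adding \<open>L x\<close> makes an \<open>L\<close>-Lipschitz function increasing.\<close>
lemma lipschitz_real_differentiable_ae:
  fixes f :: "real \<Rightarrow> real"
  assumes "L-lipschitz_on UNIV f"
  shows "negligible {x. \<not> f differentiable at x}"
proof -
  have "mono (\<lambda>x. f x + L * x)"
  proof (rule monoI)
    fix x y :: real assume "x \<le> y"
    then show "f x + L * x \<le> f y + L * y"
      using lipschitz_onD[OF assms, of x y] by (auto simp: dist_real_def algebra_simps)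
  qed
  moreover have "(L + L)-lipschitz_on UNIV (\<lambda>x. f x + L * x)"
    using lipschitz_on_nonneg[OF assms]
    by (intro lipschitz_intros assms) (auto intro!: lipschitz_onI simp: dist_real_def abs_mult simp flip: right_diff_distrib)
  ultimately have "negligible {x. \<not> (\<lambda>x. f x + L * x) differentiable at x}"
    by (rule mono_lipschitz_differentiable_ae)
  moreover have "f differentiable at x" if "(\<lambda>x. f x + L * x) differentiable at x" for x
  proof -
    have "(\<lambda>x. (f x + L * x) - L * x) differentiable at x"
      by (intro derivative_intros that) 
    then show ?thesis by simp
  qed
  ultimately show ?thesis
    by (elim negligible_subset) auto
qed

section \<open>Null sets in higher dimension\<close>

lemma negligible_UN:
  assumes "countable I" "\<And>i. i \<in> I \<Longrightarrow> negligible (S i)"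
  shows "negligible (\<Union>i\<in>I. S i)"
  using assms by (intro negligible_countable_Union countable_image) auto

text \<open>
  By Tonelli's theorem and translation invariance: the measure of \<open>N\<close> is the average over
  \<open>t \<in> [0,1]\<close> of the measures of its translates along \<open>t v\<close>, and exchanging the order of
  integration turns this average into an integral over the lines.
\<close>
lemma null_set_from_parallel_lines:
  fixes N :: "'a::euclidean_space set"
  assumes N[measurable]: "N \<in> sets borel"
    and lines: "\<And>x. {t::real. x + t *\<^sub>R v \<in> N} \<in> null_sets lborel"
  shows "N \<in> null_sets lborel"
proof -
  have "emeasure lborel N = emeasure lborel {0..1::real} * emeasure lborel N"
    by simp
  also have "\<dots> = (\<integral>\<^sup>+t. indicator {0..1::real} t * emeasure lborel N \<partial>lborel)"
    by (subst nn_integral_multc) auto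
  also have "\<dots> = (\<integral>\<^sup>+t. indicator {0..1::real} t * (\<integral>\<^sup>+x. indicator N (x + t *\<^sub>R v) \<partial>lborel) \<partial>lborel)"
  proof (rule nn_integral_cong)
    fix t :: real
    have "emeasure lborel N = emeasure (distr lborel borel ((+) (t *\<^sub>R v))) N"
      by (simp add: lborel_distr_plus)
    also have "\<dots> = (\<integral>\<^sup>+x. indicator N x \<partial>distr lborel borel ((+) (t *\<^sub>R v)))"
      by simp
    also have "\<dots> = (\<integral>\<^sup>+x. indicator N (x + t *\<^sub>R v) \<partial>lborel)"
      by (subst nn_integral_distr) (auto simp: add.commute)
    finally show "indicator {0..1::real} t * emeasure lborel N =
        indicator {0..1::real} t * (\<integral>\<^sup>+x. indicator N (x + t *\<^sub>R v) \<partial>lborel)" by simp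
  qed
  also have "\<dots> = (\<integral>\<^sup>+t. (\<integral>\<^sup>+x. indicator {0..1::real} t * indicator N (x + t *\<^sub>R v) \<partial>lborel) \<partial>lborel)"
    by (intro nn_integral_cong nn_integral_cmult[symmetric]) auto
  also have "\<dots> = (\<integral>\<^sup>+x. (\<integral>\<^sup>+t. indicator {0..1::real} t * indicator N (x + t *\<^sub>R v) \<partial>lborel) \<partial>lborel)"
  proof (rule lborel_pair.Fubini')
    have "(\<lambda>p. fst p + snd p *\<^sub>R v) \<in> borel_measurable (lborel \<Otimes>\<^sub>M lborel)"
      by (intro borel_measurable_add borel_measurable_scaleR) auto
    from measurable_compose[OF this borel_measurable_indicator[OF N]]
    show "(\<lambda>(x, t). indicator {0..1::real} t * indicator N (x + t *\<^sub>R v) :: ennreal)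
        \<in> borel_measurable (lborel \<Otimes>\<^sub>M lborel)"
      unfolding split_def
      by (intro borel_measurable_times_ennreal measurable_compose[OF measurable_snd]) auto
  qed
  also have "\<dots> = (\<integral>\<^sup>+x. 0 \<partial>(lborel :: 'a measure))"
  proof (rule nn_integral_cong)
    fix x
    have "(\<integral>\<^sup>+t. indicator {0..1::real} t * indicator N (x + t *\<^sub>R v) \<partial>lborel) \<le>
          (\<integral>\<^sup>+t. indicator {t::real. x + t *\<^sub>R v \<in> N} t \<partial>lborel)"
      by (intro nn_integral_mono) (auto split: split_indicator)
    also have "\<dots> = 0"
      using lines[of x] by (subst nn_integral_indicator) auto
    finally show "(\<integral>\<^sup>+t. indicator {0..1::real} t * indicator N (x + t *\<^sub>R v) \<partial>lborel) = 0" by simp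
  qed
  finally show ?thesis by auto
qed

section \<open>Rademacher's theorem\<close>

text \<open>
  Two linear forms that approximate the same increment up to \<open>\<epsilon>\<close> and \<open>\<epsilon>'\<close> differ by at most
  \<open>\<epsilon> + \<epsilon>'\<close> in norm. Hence the approximating forms are a Cauchy family, and their limit is the
  derivative.
\<close>
lemma differentiable_if_almost_linear:
  fixes g :: "'a::euclidean_space \<Rightarrow> real"
  assumes g: "\<And>\<epsilon>. 0 < \<epsilon> \<Longrightarrow> \<exists>w. \<exists>\<delta>>0. \<forall>h. norm h < \<delta> \<longrightarrow> \<bar>g (x + h) - g x - w \<bullet> h\<bar> \<le> \<epsilon> * norm h"
  shows "g differentiable at x"
proof -
  define \<epsilon> where "\<epsilon> n = inverse (real (Suc n))" for n
  have \<epsilon>: "0 < \<epsilon> n" for n by (simp add: \<epsilon>_def)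
  obtain w where "\<And>n. \<exists>\<delta>>0. \<forall>h. norm h < \<delta> \<longrightarrow> \<bar>g (x + h) - g x - w n \<bullet> h\<bar> \<le> \<epsilon> n * norm h"
    using g[OF \<epsilon>] by metis
  then obtain \<delta> where \<delta>: "\<And>n. \<delta> n > 0"
      and w: "\<And>n h. norm h < \<delta> n \<Longrightarrow> \<bar>g (x + h) - g x - w n \<bullet> h\<bar> \<le> \<epsilon> n * norm h"
    by metis
  have close: "norm (w m - w n) \<le> \<epsilon> m + \<epsilon> n" for m n
  proof (cases "w m = w n")
    case True
    then show ?thesis using \<epsilon>[of m] \<epsilon>[of n] by simp
  next
    case False
    (* evaluating both approximations on a short multiple of w m - w n measures this difference *)
    define u where "u = w m - w n"
    define s where "s = min (\<delta> m) (\<delta> n) / (2 * norm u)"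
    have u: "norm u > 0" using False by (simp add: u_def)
    have s: "s > 0" using \<delta>[of m] \<delta>[of n] u by (simp add: s_def)
    have "norm (s *\<^sub>R u) = s * norm u" using s by simp
    also have "\<dots> = min (\<delta> m) (\<delta> n) / 2" using u by (simp add: s_def)
    finally have "norm (s *\<^sub>R u) = min (\<delta> m) (\<delta> n) / 2" .
    then have h: "norm (s *\<^sub>R u) < \<delta> m" "norm (s *\<^sub>R u) < \<delta> n"
      using \<delta>[of m] \<delta>[of n] by auto
    have "u \<bullet> (s *\<^sub>R u) = w m \<bullet> (s *\<^sub>R u) - w n \<bullet> (s *\<^sub>R u)"
      by (simp only: u_def inner_diff_left)
    also have "\<dots> \<le> \<epsilon> m * norm (s *\<^sub>R u) + \<epsilon> n * norm (s *\<^sub>R u)"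
      using w[OF h(1)] w[OF h(2)] by linarith
    also have "\<dots> = (s * norm u) * (\<epsilon> m + \<epsilon> n)"
      using s by (simp add: algebra_simps)
    finally have "(s * norm u) * norm u \<le> (s * norm u) * (\<epsilon> m + \<epsilon> n)"
      by (simp add: dot_square_norm power2_eq_square mult.assoc)
    then show ?thesis
      using s u by (simp add: u_def)
  qed
  have \<epsilon>_mono: "\<epsilon> n \<le> \<epsilon> N" if "N \<le> n" for n N
    using that by (simp add: \<epsilon>_def field_simps)
  have "Cauchy w"
  proof (rule metric_CauchyI)
    fix e :: real assume "0 < e"
    then obtain N where N: "\<epsilon> N < e / 2"
      using reals_Archimedean[of "e / 2"] by (auto simp: \<epsilon>_def)
    have "dist (w m) (w n) < e" if "m \<ge> N" "n \<ge> N" for m n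
      using close[of m n] \<epsilon>_mono[of N m] \<epsilon>_mono[of N n] that N by (simp add: dist_norm)
    then show "\<exists>M. \<forall>m\<ge>M. \<forall>n\<ge>M. dist (w m) (w n) < e" by blast
  qed
  then obtain w0 where w0: "w \<longlonglongrightarrow> w0"
    using Cauchy_convergent_iff convergent_def by blast
  have "(g has_derivative (\<lambda>h. w0 \<bullet> h)) (at x)"
    unfolding has_derivative_at_alt
  proof (intro conjI allI impI bounded_linear_inner_right)
    fix e :: real assume "0 < e"
    then obtain N1 where N1: "\<epsilon> N1 < e / 2"
      using reals_Archimedean[of "e / 2"] by (auto simp: \<epsilon>_def)
    obtain N2 where N2: "\<And>n. n \<ge> N2 \<Longrightarrow> norm (w n - w0) < e / 2"
      using LIMSEQ_D[OF w0, of "e / 2"] \<open>0 < e\<close> by auto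
    define N where "N = max N1 N2"
    have N: "\<epsilon> N < e / 2" "norm (w N - w0) < e / 2"
      using N1 N2[of N] \<epsilon>_mono[of N1 N] by (auto simp: N_def)
    show "\<exists>d>0. \<forall>y. norm (y - x) < d \<longrightarrow> norm (g y - g x - w0 \<bullet> (y - x)) \<le> e * norm (y - x)"
    proof (intro exI[of _ "\<delta> N"] conjI allI impI \<delta>)
      fix y assume y: "norm (y - x) < \<delta> N"
      have "\<bar>g y - g x - w N \<bullet> (y - x)\<bar> \<le> \<epsilon> N * norm (y - x)"
        using w[OF y] by simp
      moreover have "\<bar>(w N - w0) \<bullet> (y - x)\<bar> \<le> norm (w N - w0) * norm (y - x)"
        by (rule Cauchy_Schwarz_ineq2)
      moreover have "norm (w N - w0) * norm (y - x) \<le> e / 2 * norm (y - x)" "\<epsilon> N * norm (y - x) \<le> e / 2 * norm (y - x)"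
        using N by (intro mult_right_mono; simp)+
      ultimately show "norm (g y - g x - w0 \<bullet> (y - x)) \<le> e * norm (y - x)"
        by (simp add: inner_diff_left)
    qed
  qed
  then show ?thesis
    by (rule differentiableI)
qed

text \<open>
  Existence of directional derivatives, made quantitative in the scale \<open>\<delta>\<close>, the slopes
  \<open>w \<bullet> v\<close> and the error \<open>\<epsilon>\<close>. The slopes are read off one vector \<open>w\<close> so that countably many
  parameters suffice. For continuous \<open>g\<close> these sets are closed, which settles all questions of
  measurability below.
\<close>
definition almost_linear_along ::
    "('a::euclidean_space \<Rightarrow> real) \<Rightarrow> 'a set \<Rightarrow> real \<Rightarrow> 'a \<Rightarrow> real \<Rightarrow> 'a set" where
  "almost_linear_along g V \<delta> w \<epsilon> =
    {x. \<forall>v\<in>V. \<forall>t. \<bar>t\<bar> \<le> \<delta> \<longrightarrow> \<bar>g (x + t *\<^sub>R v) - g x - t * (w \<bullet> v)\<bar> \<le> \<epsilon> * \<bar>t\<bar>}"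

lemma closed_almost_linear_along:
  assumes "continuous_on UNIV g"
  shows "closed (almost_linear_along g V \<delta> w \<epsilon>)"
proof -
  have "almost_linear_along g V \<delta> w \<epsilon> =
      (\<Inter>v\<in>V. \<Inter>t\<in>{t. \<bar>t\<bar> \<le> \<delta>}. {x. \<bar>g (x + t *\<^sub>R v) - g x - t * (w \<bullet> v)\<bar> \<le> \<epsilon> * \<bar>t\<bar>})"
    by (auto simp: almost_linear_along_def)
  then show ?thesis
    using assms
    by (auto intro!: closed_INT closed_Collect_le continuous_intros continuous_on_compose2[OF assms])
qed

text \<open>
  Walk from \<open>x\<close> to \<open>x + h\<close> one coordinate at a time. Every corner of the path has a point \<open>z\<close> of the
  set nearby, at which the next coordinate step is almost linear with the same slope;
  the Lipschitz condition transfers this from \<open>z\<close> to the corner.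
\<close>
lemma almost_linear_at_nonporous_point:
  fixes g :: "'a::euclidean_space \<Rightarrow> real"
  assumes g: "L-lipschitz_on UNIV g" and x: "x \<in> almost_linear_along g Basis \<delta> w \<epsilon>"
    and \<delta>: "0 < \<delta>" and \<epsilon>: "0 < \<epsilon>"
    and near: "\<And>y. 0 < dist x y \<Longrightarrow> dist x y < \<delta> \<Longrightarrow>
       \<exists>z \<in> almost_linear_along g Basis \<delta> w \<epsilon>. dist y z \<le> \<epsilon> * dist x y"
    and h: "norm h < \<delta>"
  shows "\<bar>g (x + h) - g x - w \<bullet> h\<bar> \<le> real DIM('a) * (2 * L + 1) * \<epsilon> * norm h"
proof -
  define p where "p B = (\<Sum>b\<in>B. (h \<bullet> b) *\<^sub>R b)" for B
  have L: "0 \<le> L" using lipschitz_on_nonneg[OF g] .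
  have lip: "\<bar>g y - g z\<bar> \<le> L * dist y z" for y z
    using lipschitz_onD[OF g, of y z] by (simp add: dist_real_def)
  have "\<bar>g (x + p B) - g x - w \<bullet> p B\<bar> \<le> real (card B) * ((2 * L + 1) * \<epsilon> * norm h)"
    if "finite B" "B \<subseteq> Basis" for B
    using that
  proof (induction B)
    case empty
    show ?case by (simp add: p_def)
  next
    case (insert b B)
    let ?y = "x + p B" and ?t = "h \<bullet> b"
    have b: "b \<in> Basis" using insert by auto
    have pB: "p (insert b B) = p B + ?t *\<^sub>R b"
      using insert by (simp add: p_def add.commute)
    have "norm (p B) \<le> norm h"
    proof (rule norm_le_componentwise)
      fix c :: 'a assume c: "c \<in> Basis"
      have "p B \<bullet> c = (\<Sum>b\<in>B. if b = c then h \<bullet> b else 0)"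
        unfolding p_def inner_sum_left
        using insert.prems c by (intro sum.cong) (auto simp: inner_Basis)
      also have "\<dots> = (if c \<in> B then h \<bullet> c else 0)"
        using insert.hyps by (simp add: sum.delta)
      finally show "\<bar>p B \<bullet> c\<bar> \<le> \<bar>h \<bullet> c\<bar>" by simp
    qed
    then have y: "dist x ?y \<le> norm h" by (simp add: dist_norm)
    obtain z where z: "z \<in> almost_linear_along g Basis \<delta> w \<epsilon>" "dist ?y z \<le> \<epsilon> * norm h"
    proof (cases "dist x ?y = 0")
      case True
      then show ?thesis using that[of x] x \<epsilon> by simp
    next
      case False
      then obtain z where "z \<in> almost_linear_along g Basis \<delta> w \<epsilon>" "dist ?y z \<le> \<epsilon> * dist x ?y"
        using near[of ?y] le_less_trans[OF y h] False zero_le_dist[of x ?y]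
        by (metis order_le_imp_less_or_eq)
      moreover have "\<epsilon> * dist x ?y \<le> \<epsilon> * norm h" using y \<epsilon> by simp
      ultimately show ?thesis using that by fastforce
    qed
    have t: "\<bar>?t\<bar> \<le> norm h" using b by (rule Basis_le_norm)
    have "\<bar>g (z + ?t *\<^sub>R b) - g z - ?t * (w \<bullet> b)\<bar> \<le> \<epsilon> * \<bar>?t\<bar>"
      using z(1) b t h by (auto simp: almost_linear_along_def)
    also have "\<dots> \<le> \<epsilon> * norm h" using t \<epsilon> by simp
    finally have 1: "\<bar>g (z + ?t *\<^sub>R b) - g z - ?t * (w \<bullet> b)\<bar> \<le> \<epsilon> * norm h" .
    have "L * dist ?y z \<le> L * (\<epsilon> * norm h)" using z(2) L by (rule mult_left_mono)
    then have 2: "\<bar>g (?y + ?t *\<^sub>R b) - g (z + ?t *\<^sub>R b)\<bar> \<le> L * (\<epsilon> * norm h)" "\<bar>g ?y - g z\<bar> \<le> L * (\<epsilon> * norm h)"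
      using lip[of "?y + ?t *\<^sub>R b" "z + ?t *\<^sub>R b"] lip[of ?y z] by simp_all
    have IH: "\<bar>g ?y - g x - w \<bullet> p B\<bar> \<le> real (card B) * ((2 * L + 1) * \<epsilon> * norm h)"
      using insert by simp
    have "g (x + p (insert b B)) - g x - w \<bullet> p (insert b B) =
        (g (?y + ?t *\<^sub>R b) - g (z + ?t *\<^sub>R b)) + (g (z + ?t *\<^sub>R b) - g z - ?t * (w \<bullet> b))
        - (g ?y - g z) + (g ?y - g x - w \<bullet> p B)"
      by (simp add: pB inner_add_right add.assoc)
    then have "\<bar>g (x + p (insert b B)) - g x - w \<bullet> p (insert b B)\<bar> \<le>
        2 * (L * (\<epsilon> * norm h)) + \<epsilon> * norm h + real (card B) * ((2 * L + 1) * \<epsilon> * norm h)"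
      using 1 2 IH by linarith
    then show ?case
      using insert.hyps by (simp add: algebra_simps)
  qed
  from this[of Basis] show ?thesis
    by (simp add: p_def euclidean_representation mult.assoc)
qed

text \<open>
  The ball around \<open>y\<close> of radius \<open>(1 + \<epsilon>) * dist x y\<close> contains both \<open>x\<close> and the hole of radius
  \<open>\<epsilon> * dist x y\<close>, and the hole takes up a fixed proportion of its volume.
\<close>
lemma porous_points_negligible:
  fixes A :: "'a::euclidean_space set"
  assumes "A \<in> sets borel" "0 < \<epsilon>"
  shows "negligible {x \<in> A. \<forall>\<delta>>0. \<exists>y. 0 < dist x y \<and> dist x y < \<delta> \<and> (\<forall>z\<in>A. \<epsilon> * dist x y < dist y z)}"
    (is "negligible ?P")
proof (rule negligible_low_density[of A _ "(\<epsilon> / (1 + \<epsilon>)) ^ DIM('a)"])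
  fix x :: 'a and d :: real
  assume x: "x \<in> ?P" and "0 < d"
  then have "d / (1 + \<epsilon>) > 0" using \<open>0 < \<epsilon>\<close> by simp
  then obtain y where y: "0 < dist x y" "dist x y < d / (1 + \<epsilon>)" "\<forall>z\<in>A. \<epsilon> * dist x y < dist y z"
    using x by blast
  define r where "r = (1 + \<epsilon>) * dist x y"
  have r: "0 < r" "r < d"
    using y \<open>0 < \<epsilon>\<close> by (simp_all add: r_def pos_less_divide_eq mult.commute)
  have er: "\<epsilon> / (1 + \<epsilon>) * r = \<epsilon> * dist x y"
    using \<open>0 < \<epsilon>\<close> by (simp add: r_def add_eq_0_iff)
  have "ennreal ((\<epsilon> / (1 + \<epsilon>)) ^ DIM('a)) * emeasure lborel (cball y r) = emeasure lborel (cball y (\<epsilon> * dist x y))"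
    using r y \<open>0 < \<epsilon>\<close>
    by (simp add: emeasure_cball power_mult_distrib mult_ac er[symmetric] power_divide flip: ennreal_mult)
  also have "\<dots> \<le> emeasure lborel (cball y r - A)"
  proof (rule emeasure_mono)
    have "\<epsilon> * dist x y \<le> r" using y(1) by (simp add: r_def algebra_simps)
    then show "cball y (\<epsilon> * dist x y) \<subseteq> cball y r - A"
      using y(3) by force
  qed (use assms in auto)
  finally show "\<exists>a r. 0 < r \<and> r < d \<and> x \<in> cball a r \<and>
      ennreal ((\<epsilon> / (1 + \<epsilon>)) ^ DIM('a)) * emeasure lborel (cball a r) \<le> emeasure lborel (cball a r - A)"
    using r y(1) \<open>0 < \<epsilon>\<close>
    by (intro exI[of _ y] exI[of _ r]) (auto simp: r_def dist_commute algebra_simps)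
qed (use assms in auto)

lemma abs_increment_change_slope:
  fixes a p q \<epsilon> t :: real
  assumes "\<bar>a - t * p\<bar> \<le> \<epsilon> / 2 * \<bar>t\<bar>" "\<bar>p - q\<bar> \<le> \<epsilon> / 2"
  shows "\<bar>a - t * q\<bar> \<le> \<epsilon> * \<bar>t\<bar>"
proof -
  have "\<bar>a - t * q\<bar> \<le> \<bar>a - t * p\<bar> + \<bar>t * (p - q)\<bar>"
    using abs_triangle_ineq[of "a - t * p" "t * (p - q)"] by (simp add: right_diff_distrib)
  also have "\<bar>t * (p - q)\<bar> \<le> \<bar>t\<bar> * (\<epsilon> / 2)"
    unfolding abs_mult using assms(2) by (rule mult_left_mono) simp
  finally show ?thesis
    using assms(1) by (simp add: mult.commute)
qed

text \<open>
  On each line in direction \<open>v\<close>, the function is differentiable almost everywhere, and a point of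
  differentiability belongs to one of these sets because \<open>D\<close> is dense.
\<close>
lemma lipschitz_almost_linear_along_ae:
  fixes g :: "'a::euclidean_space \<Rightarrow> real"
  assumes g: "L-lipschitz_on UNIV g" and v: "norm v = 1"
    and D: "countable D" "\<And>X. open X \<Longrightarrow> X \<noteq> {} \<Longrightarrow> \<exists>d\<in>D. d \<in> X"
    and \<epsilon>: "0 < \<epsilon>"
  shows "negligible {x. \<forall>k. \<forall>w\<in>D. x \<notin> almost_linear_along g {v} (inverse (real (Suc k))) w \<epsilon>}" (is "negligible ?N")
proof -
  have cont: "continuous_on UNIV g" using g by (rule lipschitz_on_continuous_on)
  have "?N = UNIV - (\<Union>k. \<Union>w\<in>D. almost_linear_along g {v} (inverse (real (Suc k))) w \<epsilon>)"
    by blast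
  also have "\<dots> \<in> sets borel"
    using D(1) closed_almost_linear_along[OF cont] by (intro sets.Diff sets.countable_UN' sets.countable_UN) auto
  finally have N: "?N \<in> sets borel" .
  have "{t::real. x + t *\<^sub>R v \<in> ?N} \<in> null_sets lborel" for x
  proof -
    define f where "f t = g (x + t *\<^sub>R v)" for t
    have "L-lipschitz_on UNIV f"
    proof (rule lipschitz_onI)
      fix t s :: real
      have "dist (x + t *\<^sub>R v) (x + s *\<^sub>R v) = dist t s"
        using v by (simp add: dist_norm flip: scaleR_diff_left)
      then show "dist (f t) (f s) \<le> L * dist t s"
        using lipschitz_onD[OF g, of "x + t *\<^sub>R v" "x + s *\<^sub>R v"] by (simp add: f_def)
    qed (rule lipschitz_on_nonneg[OF g])
    then have "negligible {t. \<not> f differentiable at t}"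
      by (rule lipschitz_real_differentiable_ae)
    moreover have "x + t *\<^sub>R v \<notin> ?N" if "f differentiable at t" for t
    proof -
      obtain d where "(f has_real_derivative d) (at t)"
        by (rule real_differentiableE[OF \<open>f differentiable at t\<close>])
      then have "(f has_derivative (*) d) (at t)"
        by (simp add: has_field_derivative_def)
      then obtain \<delta> where \<delta>: "\<delta> > 0" "\<And>s. \<bar>s - t\<bar> < \<delta> \<Longrightarrow> \<bar>f s - f t - d * (s - t)\<bar> \<le> \<epsilon> / 2 * \<bar>s - t\<bar>"
      proof -
        have "\<epsilon> / 2 > 0" using \<epsilon> by simp
        then have "\<exists>\<delta>>0. \<forall>s. norm (s - t) < \<delta> \<longrightarrow> norm (f s - f t - d * (s - t)) \<le> \<epsilon> / 2 * norm (s - t)"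
          using \<open>(f has_derivative (*) d) (at t)\<close> unfolding has_derivative_at_alt by blast
        then show thesis using that unfolding real_norm_def by blast
      qed
      obtain k where k: "inverse (real (Suc k)) < \<delta>"
        using reals_Archimedean[OF \<delta>(1)] by auto
      obtain w where w: "w \<in> D" "dist (d *\<^sub>R v) w < \<epsilon> / 2"
        using D(2)[of "ball (d *\<^sub>R v) (\<epsilon> / 2)"] \<epsilon> by auto
      have "\<bar>(w - d *\<^sub>R v) \<bullet> v\<bar> \<le> norm (w - d *\<^sub>R v) * norm v"
        by (rule Cauchy_Schwarz_ineq2)
      then have wd: "\<bar>w \<bullet> v - d\<bar> \<le> \<epsilon> / 2"
        using w v by (simp add: inner_diff_left dot_square_norm dist_norm norm_minus_commute)
      have "x + t *\<^sub>R v \<in> almost_linear_along g {v} (inverse (real (Suc k))) w \<epsilon>"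
        unfolding almost_linear_along_def
      proof (intro CollectI ballI allI impI)
        fix v' s assume "v' \<in> {v}" and s: "\<bar>s\<bar> \<le> inverse (real (Suc k))"
        then have "v' = v" by simp
        have "\<bar>f (t + s) - f t - s * d\<bar> \<le> \<epsilon> / 2 * \<bar>s\<bar>"
          using \<delta>(2)[of "t + s"] s k by (simp add: mult.commute)
        then have "\<bar>f (t + s) - f t - s * (w \<bullet> v)\<bar> \<le> \<epsilon> * \<bar>s\<bar>"
          by (rule abs_increment_change_slope) (use wd in \<open>simp only: abs_minus_commute\<close>)
        then show "\<bar>g (x + t *\<^sub>R v + s *\<^sub>R v') - g (x + t *\<^sub>R v) - s * (w \<bullet> v')\<bar> \<le> \<epsilon> * \<bar>s\<bar>"
          by (simp add: f_def \<open>v' = v\<close> scaleR_add_left add.assoc)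
      qed
      then show ?thesis using w(1) by blast
    qed
    ultimately have "negligible {t::real. x + t *\<^sub>R v \<in> ?N}"
      by (elim negligible_subset) blast
    moreover have "{t::real. x + t *\<^sub>R v \<in> ?N} \<in> sets borel"
    proof -
      have "(\<lambda>t::real. x + t *\<^sub>R v) -` ?N \<inter> space borel \<in> sets borel"
        by (rule measurable_sets[OF _ N]) simp
      then show ?thesis by (simp add: vimage_def)
    qed
    ultimately show ?thesis
      by (simp add: negligible_iff_null_sets null_sets_def)
  qed
  then have "?N \<in> null_sets lborel"
    by (rule null_set_from_parallel_lines[OF N])
  then show ?thesis
    by (simp add: negligible_iff_null_sets null_sets_completionI)
qed

text \<open>
  Discard two kinds of points: those where, for some coordinate direction and some error,
  almost linearity fails at every scale, and those at which one of the countably many sets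
  \<open>A n k w\<close> is porous. At the remaining points \<open>g\<close> is almost linear in all directions up to every error.
\<close>
lemma rademacher_real:
  fixes g :: "'a::euclidean_space \<Rightarrow> real"
  assumes g: "L-lipschitz_on UNIV g"
  shows "negligible {x. \<not> g differentiable at x}"
proof -
  obtain D :: "'a set" where D: "countable D" "\<And>X. open X \<Longrightarrow> X \<noteq> {} \<Longrightarrow> \<exists>d\<in>D. d \<in> X"
    using countable_dense_setE by blast
  define e where "e n = inverse (real (Suc n))" for n
  have e: "e n > 0" for n by (simp add: e_def)
  define A where "A n k w = almost_linear_along g Basis (e k) w (e n)" for n k w
  define bad where "bad n v = {x. \<forall>k. \<forall>w\<in>D. x \<notin> almost_linear_along g {v} (e k) w (e n)}" for n v
  define porous where "porous n k w = {x \<in> A n k w. \<forall>\<delta>>0. \<exists>y. 0 < dist x y \<and> dist x y < \<delta> \<and>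
      (\<forall>z\<in>A n k w. e n * dist x y < dist y z)}" for n k w
  have bad: "negligible (bad n v)" if "v \<in> Basis" for n v
    unfolding bad_def e_def using that by (intro lipschitz_almost_linear_along_ae[OF g _ D]) auto
  have porous: "negligible (porous n k w)" for n k w
    unfolding porous_def using e closed_almost_linear_along[OF lipschitz_on_continuous_on[OF g]]
    by (intro porous_points_negligible) (auto simp: A_def)
  have diff: "g differentiable at x"
    if x: "\<And>n v. v \<in> Basis \<Longrightarrow> x \<notin> bad n v" "\<And>n k w. w \<in> D \<Longrightarrow> x \<notin> porous n k w" for x
  proof (rule differentiable_if_almost_linear)
    fix \<epsilon> :: real assume "0 < \<epsilon>"
    have L: "0 \<le> L" using g by (rule lipschitz_on_nonneg)
    (* c is the loss factor of almost_linear_at_nonporous_point, compensated by the choice of n *)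
    define c where "c = real DIM('a) * (2 * L + 1)"
    have "c > 0" using L by (simp add: c_def)
    then obtain n where n: "e n < \<epsilon> / c"
      using reals_Archimedean[of "\<epsilon> / c"] \<open>0 < \<epsilon>\<close> by (auto simp: e_def)
    obtain m where m: "e m < e n / 2"
      using reals_Archimedean[of "e n / 2"] e[of n] by (auto simp: e_def)
    have "\<exists>k w. x \<in> almost_linear_along g {v} (e k) w (e m)" if "v \<in> Basis" for v
      using x(1)[OF that, of m] by (auto simp: bad_def)
    then obtain k w where kw: "\<And>v. v \<in> Basis \<Longrightarrow> x \<in> almost_linear_along g {v} (e (k v)) (w v) (e m)"
      by metis
    define K where "K = Max (k ` Basis)"
    have K: "e K \<le> e (k v)" if "v \<in> Basis" for v
    proof -
      have "k v \<le> K" using that by (auto simp: K_def)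
      then show ?thesis by (simp add: e_def field_simps)
    qed
    (* The slopes in the separate directions are collected in one vector, which is then replaced
       by an element of D at the price of doubling the error. *)
    define w0 where "w0 = (\<Sum>v\<in>Basis. (w v \<bullet> v) *\<^sub>R v)"
    obtain W where W: "W \<in> D" "dist w0 W < e n / 2"
      using D(2)[of "ball w0 (e n / 2)"] e[of n] by auto
    have "x \<in> A n K W"
      unfolding A_def almost_linear_along_def
    proof (intro CollectI ballI allI impI)
      fix v :: 'a and t assume v: "v \<in> Basis" and t: "\<bar>t\<bar> \<le> e K"
      have 1: "\<bar>g (x + t *\<^sub>R v) - g x - t * (w v \<bullet> v)\<bar> \<le> e m * \<bar>t\<bar>"
        using kw[OF v] K[OF v] t by (auto simp: almost_linear_along_def)
      have 2: "e m * \<bar>t\<bar> \<le> e n / 2 * \<bar>t\<bar>" using m by (intro mult_right_mono) auto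
      have "w0 \<bullet> v = w v \<bullet> v" using v by (simp add: w0_def)
      then have "\<bar>w v \<bullet> v - W \<bullet> v\<bar> = \<bar>(w0 - W) \<bullet> v\<bar>" by (simp add: inner_diff_left)
      also have "\<dots> \<le> e n / 2" using Basis_le_norm[OF v, of "w0 - W"] W(2) by (simp add: dist_norm)
      finally have 3: "\<bar>w v \<bullet> v - W \<bullet> v\<bar> \<le> e n / 2" .
      show "\<bar>g (x + t *\<^sub>R v) - g x - t * (W \<bullet> v)\<bar> \<le> e n * \<bar>t\<bar>"
        by (rule abs_increment_change_slope[OF order.trans[OF 1 2] 3])
    qed
    moreover have "x \<notin> porous n K W" using x(2) W(1) .
    ultimately have "\<not> (\<forall>\<delta>>0. \<exists>y. 0 < dist x y \<and> dist x y < \<delta> \<and> (\<forall>z\<in>A n K W. e n * dist x y < dist y z))"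
      unfolding porous_def by blast
    then obtain \<delta> where \<delta>: "\<delta> > 0"
        "\<And>y. 0 < dist x y \<Longrightarrow> dist x y < \<delta> \<Longrightarrow> \<exists>z\<in>A n K W. dist y z \<le> e n * dist x y"
      by (meson not_less)
    define \<delta>' where "\<delta>' = min \<delta> (e K)"
    have sub: "A n K W \<subseteq> almost_linear_along g Basis \<delta>' W (e n)"
      by (auto simp: A_def almost_linear_along_def \<delta>'_def)
    have "\<bar>g (x + h) - g x - W \<bullet> h\<bar> \<le> \<epsilon> * norm h" if h: "norm h < \<delta>'" for h
    proof -
      have "\<bar>g (x + h) - g x - W \<bullet> h\<bar> \<le> real DIM('a) * (2 * L + 1) * e n * norm h"
      proof (rule almost_linear_at_nonporous_point[OF g _ _ e _ h])
        show "x \<in> almost_linear_along g Basis \<delta>' W (e n)" using \<open>x \<in> A n K W\<close> sub by blast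
        show "0 < \<delta>'" using \<delta>(1) e by (simp add: \<delta>'_def)
        show "\<exists>z\<in>almost_linear_along g Basis \<delta>' W (e n). dist y z \<le> e n * dist x y"
          if "0 < dist x y" "dist x y < \<delta>'" for y
          using \<delta>(2)[of y] that sub by (auto simp: \<delta>'_def)
      qed
      also have "\<dots> \<le> \<epsilon> * norm h"
        unfolding c_def[symmetric] using n \<open>c > 0\<close>
        by (intro mult_right_mono) (simp_all add: pos_less_divide_eq mult.commute)
      finally show ?thesis .
    qed
    then show "\<exists>w. \<exists>\<delta>>0. \<forall>h. norm h < \<delta> \<longrightarrow> \<bar>g (x + h) - g x - w \<bullet> h\<bar> \<le> \<epsilon> * norm h"
      using \<delta>(1) e[of K] by (intro exI[of _ W] exI[of _ \<delta>']) (auto simp: \<delta>'_def)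
  qed
  have "negligible ((\<Union>n. \<Union>v\<in>Basis. bad n v) \<union> (\<Union>n. \<Union>k. \<Union>w\<in>D. porous n k w))"
    using D(1) bad porous
    by (intro negligible_Un negligible_UN) (auto simp: countable_finite)
  moreover have "{x. \<not> g differentiable at x} \<subseteq> (\<Union>n. \<Union>v\<in>Basis. bad n v) \<union> (\<Union>n. \<Union>k. \<Union>w\<in>D. porous n k w)"
  proof (rule subsetI, rule ccontr)
    fix x
    assume "x \<in> {x. \<not> g differentiable at x}"
      and "x \<notin> (\<Union>n. \<Union>v\<in>Basis. bad n v) \<union> (\<Union>n. \<Union>k. \<Union>w\<in>D. porous n k w)"
    then show False
      using diff[of x] by simp
  qed
  ultimately show ?thesis
    by (rule negligible_subset)
qed

text \<open>
  Composition with the nearest-point projection onto the ball, which does not increase distances,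
  extends \<open>f\<close> to a Lipschitz function on the whole space; the components are then treated one by one.
\<close>
lemma rademacher:
  fixes f :: "'a::euclidean_space \<Rightarrow> 'b::euclidean_space"
  assumes f: "L-lipschitz_on (cball a r) f"
  shows "negligible {x \<in> ball a r. \<not> f differentiable at x}"
proof (cases "0 < r")
  case True
  define g where "g b x = f (closest_point (cball a r) x) \<bullet> b" for b x
  have "L-lipschitz_on UNIV (g b)" if "b \<in> Basis" for b
  proof (rule lipschitz_onI)
    show "0 \<le> L" using f by (rule lipschitz_on_nonneg)
    fix x y :: 'a
    let ?x = "closest_point (cball a r) x" and ?y = "closest_point (cball a r) y"
    have cp: "?x \<in> cball a r" "?y \<in> cball a r"
      using True by (auto intro!: closest_point_in_set simp del: mem_cball)
    have "dist (g b x) (g b y) = \<bar>(f ?x - f ?y) \<bullet> b\<bar>"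
      by (simp add: g_def dist_real_def inner_diff_left)
    also have "\<dots> \<le> dist (f ?x) (f ?y)"
      using Basis_le_norm[OF that] by (simp add: dist_norm)
    also have "\<dots> \<le> L * dist ?x ?y"
      using lipschitz_onD[OF f cp] .
    also have "\<dots> \<le> L * dist x y"
      using True \<open>0 \<le> L\<close> by (intro mult_left_mono closest_point_lipschitz) auto
    finally show "dist (g b x) (g b y) \<le> L * dist x y" .
  qed
  then have "negligible (\<Union>b\<in>Basis. {x. \<not> g b differentiable at x})"
    using rademacher_real by (intro negligible_UN countable_finite) auto
  moreover have "f differentiable at x" if x: "x \<in> ball a r" and d: "\<And>b. b \<in> Basis \<Longrightarrow> g b differentiable at x" for x
  proof -
    obtain s where s: "s > 0" "ball x s \<subseteq> ball a r"
      using x open_ball openE by blast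
    have "(\<lambda>y. f y \<bullet> b) differentiable at x" if b: "b \<in> Basis" for b
    proof (rule differentiable_transform_within[OF d[OF b] s(1)])
      fix y assume "dist y x < s"
      then have "y \<in> cball a r" using s(2) by (force simp: dist_commute)
      then show "g b y = f y \<bullet> b" by (simp add: g_def closest_point_self)
    qed simp
    then show ?thesis
      by (subst differentiable_componentwise_within) simp
  qed
  ultimately show ?thesis
    by (elim negligible_subset) blast
next
  case False
  then have "{x \<in> ball a r. \<not> f differentiable at x} = {}" by (auto dest: le_less_trans[OF zero_le_dist])
  then show ?thesis by (simp only: negligible_empty)
qed

section \<open>Nonemptiness of Clarke's Jacobian\<close>

lemma has_derivative_norm_le_lipschitz:
  fixes f :: "'a::real_normed_vector \<Rightarrow> 'b::real_normed_vector"
  assumes f: "(f has_derivative f') (at x)" and S: "open S" "x \<in> S" and L: "L-lipschitz_on S f"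
  shows "norm (f' h) \<le> L * norm h"
proof -
  obtain s where s: "s > 0" "ball x s \<subseteq> S"
    using S openE by blast
  show ?thesis
  proof (cases "h = 0")
    case True
    then show ?thesis
      using has_derivative_linear[OF f] by (simp add: linear_0)
  next
    case False
    have "norm (f' h) \<le> L * norm h + \<epsilon>" if "\<epsilon> > 0" for \<epsilon>
    proof -
      have e: "\<epsilon> / norm h > 0" using that False by simp
      then obtain d where d: "d > 0"
          "\<And>y. norm (y - x) < d \<Longrightarrow> norm (f y - f x - f' (y - x)) \<le> \<epsilon> / norm h * norm (y - x)"
        using f unfolding has_derivative_at_alt by blast
      define t where "t = min d s / (2 * norm h)"
      have t: "t > 0" using d(1) s(1) False by (simp add: t_def)
      have "t * norm h = min d s / 2" using False by (simp add: t_def)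
      then have small: "t * norm h < d" "t * norm h < s" using d(1) s(1) by auto
      have "x + t *\<^sub>R h \<in> S"
        using small(2) s(2) t by (auto simp: subset_iff dist_norm)
      then have "norm (f (x + t *\<^sub>R h) - f x) \<le> L * (t * norm h)"
        using lipschitz_onD[OF L, of "x + t *\<^sub>R h" x] S t by (simp add: dist_norm)
      moreover have "norm (f (x + t *\<^sub>R h) - f x - f' (t *\<^sub>R h)) \<le> t * \<epsilon>"
        using d(2)[of "x + t *\<^sub>R h"] small(1) t False by (simp add: mult.commute)
      moreover have "norm (f' (t *\<^sub>R h)) = t * norm (f' h)"
        using has_derivative_linear[OF f] t by (simp add: linear_scale)
      ultimately have "t * norm (f' h) \<le> L * (t * norm h) + t * \<epsilon>"
        using norm_triangle_sub[of "f' (t *\<^sub>R h)" "f (x + t *\<^sub>R h) - f x"]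
        by (simp add: norm_minus_commute)
      then have "t * norm (f' h) \<le> t * (L * norm h + \<epsilon>)"
        by (simp add: algebra_simps)
      then show ?thesis using t by simp
    qed
    then show ?thesis by (rule field_le_epsilon)
  qed
qed

lemma jacobian_norm_le:
  fixes f :: "real^'n \<Rightarrow> real^'m"
  assumes f: "f differentiable at x" and S: "open S" "x \<in> S" and L: "L-lipschitz_on S f"
  shows "norm (jacobian f (at x)) \<le> real CARD('m) * (real CARD('n) * L)"
proof -
  have D: "(f has_derivative (\<lambda>h. jacobian f (at x) *v h)) (at x)"
    using f jacobian_works by blast
  have entry: "\<bar>jacobian f (at x) $ i $ j\<bar> \<le> L" for i j
  proof -
    have "\<bar>jacobian f (at x) $ i $ j\<bar> = \<bar>(jacobian f (at x) *v axis j 1) $ i\<bar>"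
      by (simp add: matrix_vector_mult_basis column_def)
    also have "\<dots> \<le> norm (jacobian f (at x) *v axis j 1)"
      by (rule component_le_norm_cart)
    also have "\<dots> \<le> L * norm (axis j 1 :: real^'n)"
      by (rule has_derivative_norm_le_lipschitz[OF D S L])
    finally show ?thesis by simp
  qed
  have row: "norm (jacobian f (at x) $ i) \<le> real CARD('n) * L" for i
  proof -
    have "norm (jacobian f (at x) $ i) \<le> (\<Sum>j\<in>UNIV. \<bar>jacobian f (at x) $ i $ j\<bar>)"
      by (rule norm_le_l1_cart)
    also have "\<dots> \<le> (\<Sum>j\<in>(UNIV::'n set). L)"
      by (intro sum_mono entry)
    finally show ?thesis by simp
  qed
  have "norm (jacobian f (at x)) \<le> (\<Sum>i\<in>UNIV. norm (jacobian f (at x) $ i))"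
    by (simp add: norm_vec_def L2_set_le_sum)
  also have "\<dots> \<le> (\<Sum>i\<in>(UNIV::'m set). real CARD('n) * L)"
    by (intro sum_mono row)
  finally show ?thesis by simp
qed

text \<open>
  Rademacher's theorem gives points of differentiability in each ball around \<open>\<xi>\<close>, and
  their Jacobians are bounded by the Lipschitz condition, so a subsequence converges.
\<close>
lemma limiting_jacobian_exists:
  fixes f :: "real^'n \<Rightarrow> real^'m"
  assumes X: "open X" "\<xi> \<in> X" and f: "locally_lipschitz_on X f"
  obtains s A where "\<And>i. s i \<in> X" "\<And>i. f differentiable at (s i)" "s \<longlonglongrightarrow> \<xi>"
    "(\<lambda>i. jacobian f (at (s i))) \<longlonglongrightarrow> A"
proof -
  obtain u L where u: "u > 0" "L-lipschitz_on (ball \<xi> u \<inter> X) f"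
    using f X by (auto simp: locally_lipschitz_on_def)
  obtain r where r: "r > 0" "cball \<xi> r \<subseteq> ball \<xi> u \<inter> X"
  proof -
    have "open (ball \<xi> u \<inter> X)" "\<xi> \<in> ball \<xi> u \<inter> X"
      using X u(1) by auto
    then show thesis using that open_contains_cball by blast
  qed
  have L: "L-lipschitz_on (cball \<xi> r) f" "L-lipschitz_on (ball \<xi> r) f"
    using u(2) r(2) ball_subset_cball[of \<xi> r] by (meson lipschitz_on_mono order.refl order.trans)+
  have "\<exists>x \<in> ball \<xi> (min r (inverse (real (Suc i)))). f differentiable at x" for i
  proof (rule ccontr)
    assume "\<not> ?thesis"
    then have "ball \<xi> (min r (inverse (real (Suc i)))) \<subseteq> {x \<in> ball \<xi> r. \<not> f differentiable at x}"
      by auto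
    then have "negligible (ball \<xi> (min r (inverse (real (Suc i)))))"
      using rademacher[OF L(1)] negligible_subset by blast
    then have "ball \<xi> (min r (inverse (real (Suc i)))) = {}"
      using open_not_negligible by blast
    then show False using r(1) by (auto simp: min_def split: if_splits)
  qed
  then obtain s where s: "\<And>i. s i \<in> ball \<xi> (min r (inverse (real (Suc i))))" "\<And>i. f differentiable at (s i)"
    by metis
  have "s \<longlonglongrightarrow> \<xi>"
  proof (rule metric_LIMSEQ_I)
    fix e :: real assume "e > 0"
    then obtain N where N: "inverse (real (Suc N)) < e"
      using reals_Archimedean by blast
    have "dist (s n) \<xi> < e" if "n \<ge> N" for n
    proof -
      have "inverse (real (Suc n)) \<le> inverse (real (Suc N))"
        using that by (simp add: field_simps)
      moreover have "dist (s n) \<xi> < inverse (real (Suc n))"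
        using s(1)[of n] by (simp add: dist_commute)
      ultimately show ?thesis
        using N by linarith
    qed
    then show "\<exists>N. \<forall>n\<ge>N. dist (s n) \<xi> < e" by blast
  qed
  have "bounded (range (\<lambda>i. jacobian f (at (s i))))"
    unfolding bounded_iff using s jacobian_norm_le[OF s(2) open_ball _ L(2)] by auto
  then obtain A \<sigma> where \<sigma>: "strict_mono \<sigma>" "((\<lambda>i. jacobian f (at (s i))) \<circ> \<sigma>) \<longlonglongrightarrow> A"
    using bounded_imp_convergent_subsequence by blast
  have "s (\<sigma> i) \<in> X" for i
    using s(1)[of "\<sigma> i"] r(2) by auto
  then show thesis
    using that[of "s \<circ> \<sigma>" A] s(2) LIMSEQ_subseq_LIMSEQ[OF \<open>s \<longlonglongrightarrow> \<xi>\<close> \<sigma>(1)] \<sigma>(2)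
    by (simp add: o_def)
qed

lemma uminus_matrix_vector_mult: "(- A) *v x = - (A *v x)" for A :: "real^'n^'m"
  by (simp add: vec_eq_iff matrix_vector_mult_def sum_negf)

lemma jacobian_uminus:
  fixes f :: "real^'n \<Rightarrow> real^'m"
  assumes "f differentiable at x"
  shows "jacobian (\<lambda>x. - f x) (at x) = - jacobian f (at x)"
proof -
  have "((\<lambda>x. - f x) has_derivative (\<lambda>h. - (jacobian f (at x) *v h))) (at x)"
    using assms jacobian_works has_derivative_minus by blast
  moreover have "(\<lambda>h. - (jacobian f (at x) *v h)) = (*v) (- jacobian f (at x))"
    by (simp add: fun_eq_iff uminus_matrix_vector_mult)
  ultimately have "frechet_derivative (\<lambda>x. - f x) (at x) = (*v) (- jacobian f (at x))"
    using frechet_derivative_at by metis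
  then show ?thesis
    by (simp add: jacobian_def[of "\<lambda>x. - f x"])
qed

text \<open>
  This existence statement is what links the variational inequality, which speaks of \<open>f\<close>, to the
  invexity hypothesis, which speaks of \<open>- f\<close>. A single limit of Jacobians serves both.
\<close>
lemma clarke_jacobian_common_element:
  fixes f :: "real^'n \<Rightarrow> real^'m"
  assumes "open X" "\<xi> \<in> X" "locally_lipschitz_on X f"
  obtains A where "A \<in> clarke_jacobian X f \<xi>" "- A \<in> clarke_jacobian X (\<lambda>x. - f x) \<xi>"
proof -
  obtain s A where s: "\<And>i. s i \<in> X" "\<And>i. f differentiable at (s i)" "s \<longlonglongrightarrow> \<xi>"
      "(\<lambda>i. jacobian f (at (s i))) \<longlonglongrightarrow> A"
    using limiting_jacobian_exists[OF assms] by blast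
  have "A \<in> clarke_jacobian X f \<xi>"
    unfolding clarke_jacobian_def using s by (intro hull_inc) blast
  moreover have "(\<lambda>i. jacobian (\<lambda>x. - f x) (at (s i))) \<longlonglongrightarrow> - A"
    using tendsto_minus[OF s(4)] by (simp add: jacobian_uminus s(2))
  then have "- A \<in> clarke_jacobian X (\<lambda>x. - f x) \<xi>"
    unfolding clarke_jacobian_def using s by (intro hull_inc) (blast intro: differentiable_minus)
  ultimately show thesis by (rule that)
qed

section \<open>Efficient solutions and the variational inequality\<close>

lemma interior_cone_scaleR:
  fixes C :: "'a::real_normed_vector set"
  assumes "conic C" "x \<in> interior C" "0 < l"
  shows "l *\<^sub>R x \<in> interior C"
proof (rule interiorI)
  show "open ((*\<^sub>R) l ` interior C)"
    using assms(3) by (intro open_scaling) auto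
  show "(*\<^sub>R) l ` interior C \<subseteq> C"
    using assms interior_subset by (force intro: conicD)
qed (use assms in auto)

theorem theorem4p1:
  fixes X :: "(real^'n) set" and C :: "(real^'m) set"
    and f :: "real^'n \<Rightarrow> real^'m" and \<eta> :: "real^'n \<Rightarrow> real^'n \<Rightarrow> real^'n"
    and e :: "real^'m" and \<xi> :: "real^'n"
  assumes "open X" and "X \<noteq> {}"
    and "closed C" and "convex_cone C" and "pointed C" and "interior C \<noteq> {}"
    and "locally_lipschitz_on X f"
    and "cone_less C 0 e"
    and "affine_in_first X \<eta>"
    and "\<forall>x\<in>X. \<eta> x x = 0"
    and "\<xi> \<in> X"
    and "approx_quasi_invex_II X C \<eta> e (\<lambda>x. - f x) \<xi>"
    and "local_quasi_weak_efficient X C \<eta> e f \<xi>"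
  shows "WSVVI_solution X C \<eta> f \<xi>"
  unfolding WSVVI_solution_def
proof (intro conjI notI \<open>\<xi> \<in> X\<close>)
  assume "\<exists>x\<in>X. \<forall>A \<in> clarke_jacobian X f \<xi>. cone_less C (A *v \<eta> x \<xi>) 0"
  then obtain x where x: "x \<in> X" "\<And>A. A \<in> clarke_jacobian X f \<xi> \<Longrightarrow> cone_less C (A *v \<eta> x \<xi>) 0"
    by blast
  obtain A where A: "A \<in> clarke_jacobian X f \<xi>" "- A \<in> clarke_jacobian X (\<lambda>x. - f x) \<xi>"
    using clarke_jacobian_common_element[OF \<open>open X\<close> \<open>\<xi> \<in> X\<close> \<open>locally_lipschitz_on X f\<close>] .
  obtain r1 where r1: "r1 > 0"
      "\<And>x. x \<in> ball \<xi> r1 \<inter> X \<Longrightarrow> \<exists>A \<in> clarke_jacobian X (\<lambda>x. - f x) \<xi>. cone_less C 0 (A *v \<eta> x \<xi>) \<Longrightarrow>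
         cone_less C (- f \<xi> + norm (\<eta> x \<xi>) *\<^sub>R e) (- f x)"
    using \<open>approx_quasi_invex_II X C \<eta> e (\<lambda>x. - f x) \<xi>\<close> \<open>\<xi> \<in> X\<close>
    by (auto simp: approx_quasi_invex_II_def)
  obtain r2 where r2: "r2 > 0"
      "\<And>x. x \<in> ball \<xi> r2 \<inter> X \<Longrightarrow> \<not> cone_less C (f x + norm (\<eta> x \<xi>) *\<^sub>R e) (f \<xi>)"
    using \<open>local_quasi_weak_efficient X C \<eta> e f \<xi>\<close> by (auto simp: local_quasi_weak_efficient_def)
  (* Points on the segment from \<xi> towards x, close enough to \<xi> for both local hypotheses. *)
  define y where "y l = l *\<^sub>R x + (1 - l) *\<^sub>R \<xi>" for l
  have "(y \<longlongrightarrow> 0 *\<^sub>R x + (1 - 0) *\<^sub>R \<xi>) (at_right 0)"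
    unfolding y_def by (intro tendsto_intros)
  moreover have "open (ball \<xi> r1 \<inter> ball \<xi> r2 \<inter> X)"
    using \<open>open X\<close> by (intro open_Int) auto
  ultimately have "\<forall>\<^sub>F l in at_right 0. y l \<in> ball \<xi> r1 \<inter> ball \<xi> r2 \<inter> X"
    using \<open>\<xi> \<in> X\<close> r1(1) r2(1) by (intro topological_tendstoD) auto
  moreover have "\<forall>\<^sub>F l::real in at_right 0. l \<in> {0<..<1}"
    by (rule eventually_at_right_real) simp
  ultimately have "\<forall>\<^sub>F l::real in at_right 0. y l \<in> ball \<xi> r1 \<inter> ball \<xi> r2 \<inter> X \<and> l \<in> {0<..<1}"
    by (rule eventually_conj)
  then obtain l where l: "y l \<in> ball \<xi> r1" "y l \<in> ball \<xi> r2" "y l \<in> X" "0 < l" "l < 1"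
    using eventually_happens'[OF trivial_limit_at_right_real] by auto
  have "\<eta> (y l) \<xi> = l *\<^sub>R \<eta> x \<xi> + (1 - l) *\<^sub>R \<eta> \<xi> \<xi>"
    using \<open>affine_in_first X \<eta>\<close> x(1) \<open>\<xi> \<in> X\<close> l unfolding affine_in_first_def y_def by auto
  then have \<eta>: "\<eta> (y l) \<xi> = l *\<^sub>R \<eta> x \<xi>"
    using \<open>\<forall>x\<in>X. \<eta> x x = 0\<close> \<open>\<xi> \<in> X\<close> by simp
  have "- (A *v \<eta> x \<xi>) \<in> interior C"
    using x(2)[OF A(1)] by (simp add: cone_less_def)
  then have "l *\<^sub>R (- (A *v \<eta> x \<xi>)) \<in> interior C"
    using \<open>convex_cone C\<close> l(4) by (intro interior_cone_scaleR) (auto simp: convex_cone_def)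
  then have "cone_less C 0 ((- A) *v \<eta> (y l) \<xi>)"
    by (simp add: cone_less_def \<eta> uminus_matrix_vector_mult matrix_vector_mult_scaleR)
  then have "cone_less C (- f \<xi> + norm (\<eta> (y l) \<xi>) *\<^sub>R e) (- f (y l))"
    using A(2) l by (intro r1(2)) auto
  then have "cone_less C (f (y l) + norm (\<eta> (y l) \<xi>) *\<^sub>R e) (f \<xi>)"
    by (simp add: cone_less_def algebra_simps)
  then show False
    using r2(2) l by blast
qed

end
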